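(* Let $(\mathcal{B}_0,\mathcal{B}_1)$ be a node in the search tree constructed either by (i) applying the dominance-based branching to (MILP) or by (ii) applying the classic variable branching to (RF), and let $$\mathcal{N}_0=\bigcup_{j\in\mathcal{B}_0}\mathcal{N}_j^-,\qquad \mathcal{N}_1=\bigcup_{j\in\mathcal{B}_1}\mathcal{N}_j^+ .$$ Then the LP relaxation of (MILP) with the additional constraints $z_i=0$ for $i\in\mathcal{N}_0$ and $z_i=1$ for $i\in\mathcal{N}_1$ is equivalent to the LP relaxation of (RF) with the additional constraints $z_i=0$ for $i\in\mathcal{N}_0$ and $z_i=1$ for $i\in\mathcal{N}_1$; that is, one of these two linear programs is feasible if and only if the other is, and, whenever either of them has an optimal solution, they share at least one identical optimal solution $(x,v,z)$.
   Context: Notation: $[n]=\{1,\dots,n\}$; inequalities between vectors are componentwise. Data: a polyhedron $\mathcal{X}\subseteq\mathbb{R}^d$, an $m\times d$ real matrix $T$, a cost vector $c\in\mathbb{R}^d$, vectors $\xi^1,\dots,\xi^n\in\mathbb{R}^m$ with $\xi^i\ge 0$, probabilities $p_i\ge0$ with $\sum_{i=1}^n p_i=1$, and $\epsilon\in(0,1)$. (MILP) is: minimize $c^\top x$ over $(x,v,z)$ subject to $Tx=v$, $x\in\mathcal{X}$; $v\ge \xi^i(1-z_i)$ for all $i\in[n]$; $\sum_{i=1}^n p_iz_i\le\epsilon$; $v\in\mathbb{R}^m_+$, $z\in\{0,1\}^n$. (RF) is (MILP) with the additional dominance inequalities $z_i\le z_j$ for all $(i,j)\in\mathcal{A}:=\{(i,j)\in[n]\times[n]: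 \xi^i\le\xi^j,\ i\ne j\}$. LP relaxations are obtained by replacing $z\in\{0,1\}^n$ with $z\in[0,1]^n$. For $j\in[n]$: $\mathcal{N}_j^-=\{i\in[n]:\xi^i\le\xi^j\}$ and $\mathcal{N}_j^+=\{i\in[n]:\xi^j\le\xi^i\}$ (both contain $j$). Search trees: a node is denoted $(\mathcal{B}_0,\mathcal{B}_1)$, where $\mathcal{B}_0$ and $\mathcal{B}_1$ are the disjoint index sets of variables $z$ that have been branched on to $0$ and to $1$, respectively, on the path from the root $(\varnothing,\varnothing)$; at each branching step, a variable $z_j$ not yet fixed at the current node is chosen, and $j$ is added to $\mathcal{B}_0$ in the left child and to $\mathcal{B}_1$ in the right child. In dominance-based branching on (MILP), branching on $z_j$ creates a left child in which $z_i=0$ is imposed for all $i\in\mathcal{N}_j^-$ and a right child in which $z_i=1$ is imposed for all $i\in\mathcal{N}_j^+$. In classic variable branching on (RF), branching on $z_j$ imposes $z_j=0$ in the left child and $z_j=1$ in the right child, and further variables are fixed through the dominance inequalities. In both cases the sets of variables fixed to $0$ and to $1$ at node $(\mathcal{B}_0,\mathcal{B}_1)$ are $\mathcal{N}_0$ and $\mathcal{N}_1$ as defined in the claim. *)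

theory Defs
  imports "HOL-Analysis.Analysis"
begin

text \<open>
  The index sets \<open>[d]\<close>, \<open>[m]\<close>, \<open>[n]\<close> are the finite types \<open>'d\<close>, \<open>'m\<close>, \<open>'n\<close>.  The order on
  \<^typ>\<open>real ^ 'm\<close> is the componentwise one.
\<close>

text \<open>
  \<open>Z\<close> is the set from which every \<open>z\<^sub>i\<close> is taken: \<open>Z = {0, 1}\<close> is the
  mixed-integer problem and \<open>Z = {0..1}\<close> is its LP relaxation.
\<close>

definition MILP_feasible ::
  "real set \<Rightarrow> (real ^ 'd) set \<Rightarrow> real ^ 'd ^ 'm \<Rightarrow> ('n::finite \<Rightarrow> real ^ 'm) \<Rightarrow> ('n \<Rightarrow> real) \<Rightarrow> real
    \<Rightarrow> ((real ^ 'd) \<times> (real ^ 'm) \<times> (real ^ 'n)) set" where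
  "MILP_feasible Z X T \<xi> p \<epsilon> =
    {(x, v, z). T *v x = v \<and> x \<in> X \<and> (\<forall>i. v \<ge> (1 - z $ i) *\<^sub>R \<xi> i) \<and>
       (\<Sum>i\<in>UNIV. p i * z $ i) \<le> \<epsilon> \<and> v \<ge> 0 \<and> (\<forall>i. z $ i \<in> Z)}"

definition dominance :: "('n \<Rightarrow> real ^ 'm) \<Rightarrow> ('n \<times> 'n) set" where
  "dominance \<xi> = {(i, j). \<xi> i \<le> \<xi> j \<and> i \<noteq> j}"

definition RF_feasible ::
  "real set \<Rightarrow> (real ^ 'd) set \<Rightarrow> real ^ 'd ^ 'm \<Rightarrow> ('n::finite \<Rightarrow> real ^ 'm) \<Rightarrow> ('n \<Rightarrow> real) \<Rightarrow> real
    \<Rightarrow> ((real ^ 'd) \<times> (real ^ 'm) \<times> (real ^ 'n)) set" where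
  "RF_feasible Z X T \<xi> p \<epsilon> =
    MILP_feasible Z X T \<xi> p \<epsilon> \<inter> {(x, v, z). \<forall>(i, j) \<in> dominance \<xi>. z $ i \<le> z $ j}"

definition fixing :: "'n set \<Rightarrow> 'n set \<Rightarrow> ('x \<times> 'v \<times> (real ^ 'n)) set" where
  "fixing F0 F1 = {(x, v, z). (\<forall>i\<in>F0. z $ i = 0) \<and> (\<forall>i\<in>F1. z $ i = 1)}"

definition optimal_solution ::
  "real ^ 'd \<Rightarrow> ((real ^ 'd) \<times> 'v \<times> 'z) set \<Rightarrow> (real ^ 'd) \<times> 'v \<times> 'z \<Rightarrow> bool" where
  "optimal_solution c S = is_arg_min (\<lambda>(x, v, z). c \<bullet> x) (\<lambda>s. s \<in> S)"

definition N_minus :: "('n \<Rightarrow> real ^ 'm) \<Rightarrow> 'n \<Rightarrow> 'n set" where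
  "N_minus \<xi> j = {i. \<xi> i \<le> \<xi> j}"

definition N_plus :: "('n \<Rightarrow> real ^ 'm) \<Rightarrow> 'n \<Rightarrow> 'n set" where
  "N_plus \<xi> j = {i. \<xi> j \<le> \<xi> i}"

text \<open>
  Nodes \<open>(B0, B1)\<close> of search trees, together with the sets \<open>F0\<close>, \<open>F1\<close> of the variables fixed
  to 0 and to 1 there.  The predicates hold for every node that can be reached from the root by
  some sequence of choices of branching variables, so they cover the nodes of every search tree,
  whatever its selection and pruning rules.
\<close>

inductive dominance_branching_node ::
  "('n \<Rightarrow> real ^ 'm) \<Rightarrow> 'n set \<Rightarrow> 'n set \<Rightarrow> 'n set \<Rightarrow> 'n set \<Rightarrow> bool" for \<xi> where
  root: "dominance_branching_node \<xi> {} {} {} {}"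
| left: "dominance_branching_node \<xi> B0 B1 F0 F1 \<Longrightarrow> j \<notin> F0 \<union> F1 \<Longrightarrow>
    dominance_branching_node \<xi> (insert j B0) B1 (F0 \<union> N_minus \<xi> j) F1"
| right: "dominance_branching_node \<xi> B0 B1 F0 F1 \<Longrightarrow> j \<notin> F0 \<union> F1 \<Longrightarrow>
    dominance_branching_node \<xi> B0 (insert j B1) F0 (F1 \<union> N_plus \<xi> j)"

text \<open>
  Here only \<open>z\<^sub>j\<close> is fixed by the branching step itself; the other variables are fixed by
  propagating this value along the inequalities \<open>z\<^sub>i \<le> z\<^sub>k\<close>, \<open>(i, k) \<in> dominance \<xi>\<close>, exhaustively:
  the value 0 propagates from \<open>z\<^sub>k\<close> to \<open>z\<^sub>i\<close> and the value 1 from \<open>z\<^sub>i\<close> to \<open>z\<^sub>k\<close>.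
\<close>

inductive classic_branching_node ::
  "('n \<Rightarrow> real ^ 'm) \<Rightarrow> 'n set \<Rightarrow> 'n set \<Rightarrow> 'n set \<Rightarrow> 'n set \<Rightarrow> bool" for \<xi> where
  root: "classic_branching_node \<xi> {} {} {} {}"
| left: "classic_branching_node \<xi> B0 B1 F0 F1 \<Longrightarrow> j \<notin> F0 \<union> F1 \<Longrightarrow>
    classic_branching_node \<xi> (insert j B0) B1 (((dominance \<xi>)\<inverse>)\<^sup>* `` insert j F0) F1"
| right: "classic_branching_node \<xi> B0 B1 F0 F1 \<Longrightarrow> j \<notin> F0 \<union> F1 \<Longrightarrow>
    classic_branching_node \<xi> B0 (insert j B1) F0 ((dominance \<xi>)\<^sup>* `` insert j F1)"

lemma dominance_branching_node_fixed:
  assumes "dominance_branching_node \<xi> B0 B1 F0 F1"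
  shows "F0 = (\<Union>j\<in>B0. N_minus \<xi> j)" "F1 = (\<Union>j\<in>B1. N_plus \<xi> j)"
  using assms by (induction rule: dominance_branching_node.induct) auto

lemma rtrancl_dominance: "(i, j) \<in> (dominance \<xi>)\<^sup>* \<longleftrightarrow> \<xi> i \<le> \<xi> j"
proof
  assume "(i, j) \<in> (dominance \<xi>)\<^sup>*"
  then show "\<xi> i \<le> \<xi> j"
    by (induction rule: rtrancl_induct) (auto simp: dominance_def intro: order_trans)
next
  assume "\<xi> i \<le> \<xi> j"
  then show "(i, j) \<in> (dominance \<xi>)\<^sup>*"
    by (cases "i = j") (auto simp: dominance_def intro: r_into_rtrancl)
qed

lemma classic_branching_node_fixed:
  assumes "classic_branching_node \<xi> B0 B1 F0 F1"
  shows "F0 = (\<Union>j\<in>B0. N_minus \<xi> j)" "F1 = (\<Union>j\<in>B1. N_plus \<xi> j)"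
  using assms
  by (induction rule: classic_branching_node.induct)
     (auto simp: rtrancl_dominance rtrancl_converse N_minus_def N_plus_def Image_iff
       intro: order_trans)

end

theory Submission
  imports Defs
begin

text \<open>
  Replacing every \<open>z\<^sub>i\<close> by the minimum of the \<open>z\<^sub>j\<close> with \<open>\<xi> i \<le> \<xi> j\<close> enforces the dominance
  inequalities, and it keeps \<open>(x, v)\<close>, hence the cost.  The knapsack constraint survives because
  \<open>z\<close> only decreases, and \<open>v \<ge> (1 - z\<^sub>i) \<xi> i\<close> survives because it is implied by the old
  constraint of the index \<open>j\<close> attaining the minimum.  The fixings to 0 survive because \<open>z \<ge> 0\<close>,
  the fixings to 1 because \<open>N1\<close> is upward closed for dominance.
\<close>

text \<open>This is the greatest vector below \<open>z\<close> that is monotone for dominance. The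
  \<open>Min\<close> is over a finite set containing \<open>z $ i\<close>, so it is well
  defined.\<close>

definition dominance_min ::
  "('n::finite \<Rightarrow> real ^ 'm) \<Rightarrow> real ^ 'n \<Rightarrow> real ^ 'n" where
  "dominance_min \<xi> z = (\<chi> i. Min ((\<lambda>j. z $ j) ` N_plus \<xi> i))"

lemma dominance_min_attained:
  obtains j where "\<xi> i \<le> \<xi> j" "dominance_min \<xi> z $ i = z $ j"
proof -
  have "Min ((\<lambda>j. z $ j) ` N_plus \<xi> i) \<in> (\<lambda>j. z $ j) ` N_plus \<xi> i"
    by (rule Min_in) (auto simp: N_plus_def)
  then show ?thesis
    using that by (auto simp: dominance_min_def N_plus_def)
qed

lemma dominance_min_le: "\<xi> i \<le> \<xi> j \<Longrightarrow> dominance_min \<xi> z $ i \<le> z $ j"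
  by (auto simp: dominance_min_def N_plus_def intro!: Min_le)

text \<open>By transitivity, the index attaining the minimum for \<open>j\<close> also competes in
  the minimum for \<open>i\<close>.\<close>

lemma dominance_min_mono:
  assumes "\<xi> i \<le> \<xi> j"
  shows "dominance_min \<xi> z $ i \<le> dominance_min \<xi> z $ j"
  by (metis assms dominance_min_attained dominance_min_le order_trans)

text \<open>\<open>Z\<close> can stay abstract because every new component is one of the old ones;
  this covers both \<open>{0, 1}\<close> and \<open>{0..1}\<close>.\<close>

lemma dominance_min_RF_feasible:
  assumes nonneg: "\<And>i. p i \<ge> 0"
    and Z: "\<And>z. z \<in> Z \<Longrightarrow> z \<le> 1"
    and feasible: "(x, v, z) \<in> MILP_feasible Z X T \<xi> p \<epsilon>"
  shows "(x, v, dominance_min \<xi> z) \<in> RF_feasible Z X T \<xi> p \<epsilon>"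
proof -
  have "(1 - dominance_min \<xi> z $ i) *\<^sub>R \<xi> i \<le> v" for i
  proof -
    obtain j where j: "\<xi> i \<le> \<xi> j" "dominance_min \<xi> z $ i = z $ j"
      by (rule dominance_min_attained)
    have "z $ j \<le> 1"
      using feasible Z by (auto simp: MILP_feasible_def)
    \<comment> \<open>The bound \<open>z $ j \<le> 1\<close> makes the factor nonnegative, so that
      scaling preserves \<open>\<xi> i \<le> \<xi> j\<close>.\<close>
    then have "(1 - z $ j) *\<^sub>R \<xi> i \<le> (1 - z $ j) *\<^sub>R \<xi> j"
      using j by (intro scaleR_left_mono) auto
    also have "\<dots> \<le> v"
      using feasible by (auto simp: MILP_feasible_def)
    finally show ?thesis
      using j by simp
  qed
  moreover have "(\<Sum>i\<in>UNIV. p i * dominance_min \<xi> z $ i) \<le> (\<Sum>i\<in>UNIV. p i * z $ i)"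
    by (intro sum_mono mult_left_mono dominance_min_le nonneg order_refl)
  moreover have "dominance_min \<xi> z $ i \<in> Z" for i
  proof -
    obtain j where "dominance_min \<xi> z $ i = z $ j"
      by (rule dominance_min_attained)
    then show ?thesis
      using feasible by (simp add: MILP_feasible_def)
  qed
  ultimately show ?thesis
    using feasible dominance_min_mono[of \<xi>]
    by (auto simp: RF_feasible_def MILP_feasible_def dominance_def)
qed

lemma dominance_min_fixing:
  assumes nonneg: "\<And>i. 0 \<le> z $ i"
    and upward: "\<And>i j. i \<in> F1 \<Longrightarrow> \<xi> i \<le> \<xi> j \<Longrightarrow> j \<in> F1"
    and fixed: "(x, v, z) \<in> fixing F0 F1"
  shows "(x, v, dominance_min \<xi> z) \<in> fixing F0 F1"
proof -
  \<comment> \<open>The minimum is at most \<open>z $ i = 0\<close>, and it is itself a component of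
    \<open>z\<close>, hence nonnegative.\<close>
  have "dominance_min \<xi> z $ i = 0" if "i \<in> F0" for i
    using that fixed dominance_min_le[of \<xi> i i z] nonneg
    by (metis (mono_tags, lifting) antisym case_prodD dominance_min_attained fixing_def
        mem_Collect_eq order_refl)
  \<comment> \<open>The index attaining the minimum dominates \<open>i\<close>, so it lies in
    \<open>F1\<close> and has value 1.\<close>
  moreover have "dominance_min \<xi> z $ i = 1" if "i \<in> F1" for i
    using that fixed upward dominance_min_attained[of \<xi> i z]
    by (auto simp: fixing_def)
  ultimately show ?thesis
    by (simp add: fixing_def)
qed

lemma optimal_solution_iff:
  "optimal_solution c S (x, v, z) \<longleftrightarrow>
    (x, v, z) \<in> S \<and> (\<forall>x' v' z'. (x', v', z') \<in> S \<longrightarrow> c \<bullet> x \<le> c \<bullet> x')"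
  by (auto simp: optimal_solution_def is_arg_min_def not_less)

text \<open>The cost depends on \<open>x\<close> alone, so a repair that keeps \<open>x\<close>
  gives both problems the same attainable costs. Hence an optimum of \<open>S\<close> can be moved
  into \<open>S'\<close>, and an optimum of \<open>S'\<close> is already optimal for
  \<open>S\<close>.\<close>

lemma restriction_common_optimal_solution:
  assumes sub: "S' \<subseteq> S"
    and repair: "\<And>x v z. (x, v, z) \<in> S \<Longrightarrow> \<exists>v' z'. (x, v', z') \<in> S'"
    and opt: "(\<exists>s. optimal_solution c S s) \<or> (\<exists>s. optimal_solution c S' s)"
  shows "\<exists>x v z. optimal_solution c S (x, v, z) \<and> optimal_solution c S' (x, v, z)"
  using opt
proof
  assume "\<exists>s. optimal_solution c S s"
  then obtain x v z where "optimal_solution c S (x, v, z)"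
    by auto
  moreover from this obtain v' z' where "(x, v', z') \<in> S'"
    using repair unfolding optimal_solution_iff by blast
  ultimately have "optimal_solution c S (x, v', z') \<and> optimal_solution c S' (x, v', z')"
    using sub by (auto simp: optimal_solution_iff)
  then show ?thesis
    by blast
next
  assume "\<exists>s. optimal_solution c S' s"
  then obtain x v z where "optimal_solution c S' (x, v, z)"
    by auto
  moreover from this have "optimal_solution c S (x, v, z)"
    using sub repair by (fastforce simp: optimal_solution_iff)
  ultimately show ?thesis
    by blast
qed

theorem corollary3p4:
  fixes X :: "(real ^ 'd) set" and T :: "real ^ 'd ^ 'm" and c :: "real ^ 'd"
    and \<xi> :: "'n::finite \<Rightarrow> real ^ 'm" and p :: "'n \<Rightarrow> real" and \<epsilon> :: real
    and B0 B1 N0 N1 :: "'n set"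
    and LP_MILP LP_RF :: "((real ^ 'd) \<times> (real ^ 'm) \<times> (real ^ 'n)) set"
  assumes "polyhedron X"
    and "\<And>i. \<xi> i \<ge> 0"
    and "\<And>i. p i \<ge> 0" and "(\<Sum>i\<in>UNIV. p i) = 1"
    and "0 < \<epsilon>" and "\<epsilon> < 1"
    and "(\<exists>F0 F1. dominance_branching_node \<xi> B0 B1 F0 F1) \<or>
         (\<exists>F0 F1. classic_branching_node \<xi> B0 B1 F0 F1)"
  defines "N0 \<equiv> (\<Union>j\<in>B0. N_minus \<xi> j)" and "N1 \<equiv> (\<Union>j\<in>B1. N_plus \<xi> j)"
  defines "LP_MILP \<equiv> MILP_feasible {0..1} X T \<xi> p \<epsilon> \<inter> fixing N0 N1"
    and "LP_RF \<equiv> RF_feasible {0..1} X T \<xi> p \<epsilon> \<inter> fixing N0 N1"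
  shows "(LP_MILP \<noteq> {} \<longleftrightarrow> LP_RF \<noteq> {}) \<and>
    ((\<exists>s. optimal_solution c LP_MILP s) \<or> (\<exists>s. optimal_solution c LP_RF s) \<longrightarrow>
      (\<exists>x v z. optimal_solution c LP_MILP (x, v, z) \<and> optimal_solution c LP_RF (x, v, z)))"
proof -
  have sub: "LP_RF \<subseteq> LP_MILP"
    by (auto simp: LP_RF_def LP_MILP_def RF_feasible_def)
  have repair: "(x, v, dominance_min \<xi> z) \<in> LP_RF" if "(x, v, z) \<in> LP_MILP" for x v z
  proof -
    have "(x, v, dominance_min \<xi> z) \<in> RF_feasible {0..1} X T \<xi> p \<epsilon>"
      using that assms(3) by (intro dominance_min_RF_feasible) (auto simp: LP_MILP_def)
    moreover have "(x, v, dominance_min \<xi> z) \<in> fixing N0 N1"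
    proof (rule dominance_min_fixing)
      show "0 \<le> z $ i" for i
        using that by (auto simp: LP_MILP_def MILP_feasible_def)
      \<comment> \<open>\<open>N1\<close> is a union of sets \<open>N_plus \<xi> k\<close>, each
        upward closed by transitivity.\<close>
      show "j \<in> N1" if "i \<in> N1" "\<xi> i \<le> \<xi> j" for i j
        using that by (auto simp: N1_def N_plus_def intro: order_trans)
      show "(x, v, z) \<in> fixing N0 N1"
        using that by (simp add: LP_MILP_def)
    qed
    ultimately show ?thesis
      by (simp add: LP_RF_def)
  qed
  have "LP_MILP \<noteq> {} \<longleftrightarrow> LP_RF \<noteq> {}"
    using sub repair by fastforce
  then show ?thesis
    using restriction_common_optimal_solution[OF sub, of c] repair by blast
qed

end
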